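(* The set of states isomorphic to Pauli (generalized depolarizing) single-qubit channels, $$\hat{\mathcal{P}}=\{\alpha\mathcal{I}+\beta\mathcal{X}+\gamma\mathcal{Y}+\delta\mathcal{Z} : \alpha,\beta,\gamma,\delta\ge 0,\ \alpha+\beta+\gamma+\delta=1\},$$ is a $3$-simplex (tetrahedron) with vertices $\mathcal{I},\mathcal{X},\mathcal{Y},\mathcal{Z}$: these four matrices are mutually orthogonal for the Hilbert--Schmidt inner product, and every element of $\hat{\mathcal{P}}$ has a unique decomposition as a convex combination of them.
   Context: Let $\sigma_x,\sigma_y,\sigma_z$ be the Pauli matrices and $|\psi\rangle=\frac{1}{\sqrt2}(|00\rangle+|11\rangle)$. A Pauli (generalized depolarizing) channel is a map $\rho\mapsto\alpha\rho+\beta\sigma_x\rho\sigma_x+\gamma\sigma_y\rho\sigma_y+\delta\sigma_z\rho\sigma_z$ with $\alpha,\beta,\gamma,\delta\ge0$, $\alpha+\beta+\gamma+\delta=1$. A channel $\mathcal{E}$ on one qubit is identified with the two-qubit state $(\mathcal{E}\otimes I)(|\psi\rangle\langle\psi|)$ (Choi isomorphism). Define $\mathcal{I}=|\psi\rangle\langle\psi|$, $\mathcal{X}=(\sigma_x\otimes I)|\psi\rangle\langle\psi|(\sigma_x\otimes I)$, $\mathcal{Y}=(\sigma_y\otimes I)|\psi\rangle\langle\psi|(\sigma_y\otimes I)$, $\mathcal{Z}=(\sigma_z\otimes I)|\psi\rangle\langle\psi|(\sigma_z\otimes I)$, so that a Pauli channel with weights $\alpha,\beta,\gamma,\delta$ corresponds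 to $\alpha\mathcal{I}+\beta\mathcal{X}+\gamma\mathcal{Y}+\delta\mathcal{Z}$. The Hilbert--Schmidt inner product is $\mathrm{Tr}(P^\dagger Q)$. An $n$-simplex is the convex hull of $n+1$ affinely independent points. *)

theory Defs
  imports "HOL-Analysis.Analysis"
begin

definition dagger :: "complex ^ 'n ^ 'm \<Rightarrow> complex ^ 'm ^ 'n" where
  "dagger A = (\<chi> i j. cnj (A $ j $ i))"

definition hs_inner :: "complex ^ 'n ^ 'n \<Rightarrow> complex ^ 'n ^ 'n \<Rightarrow> complex" where
  "hs_inner P Q = trace (dagger P ** Q)"

definition ket_bra :: "complex ^ 'n \<Rightarrow> complex ^ 'n ^ 'n" where
  "ket_bra v = (\<chi> i j. v $ i * cnj (v $ j))"

text \<open>Tensor products are indexed by pairs of indices; the first component belongs to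
  the first tensor factor.\<close>

definition tensor_vec :: "complex ^ 'a \<Rightarrow> complex ^ 'b \<Rightarrow> complex ^ ('a \<times> 'b)" where
  "tensor_vec u v = (\<chi> p. u $ fst p * v $ snd p)"

definition tensor_mat ::
  "complex ^ 'a ^ 'a \<Rightarrow> complex ^ 'b ^ 'b \<Rightarrow> complex ^ ('a \<times> 'b) ^ ('a \<times> 'b)" where
  "tensor_mat A B = (\<chi> p q. A $ fst p $ fst q * B $ snd p $ snd q)"

text \<open>The map \<open>E \<otimes> I\<close>, for linear \<open>E\<close>: write
  \<open>\<rho> = (\<Sum>j l. R\<^sub>j\<^sub>l \<otimes> e\<^sub>j\<^sub>l)\<close> with \<open>e\<^sub>j\<^sub>l\<close> the matrix units of the second factor,
  and apply \<open>E\<close> to every \<open>R\<^sub>j\<^sub>l\<close>.\<close>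

definition extend_map ::
  "(complex ^ 'a ^ 'a \<Rightarrow> complex ^ 'a ^ 'a) \<Rightarrow>
   complex ^ ('a \<times> 'b::finite) ^ ('a \<times> 'b) \<Rightarrow> complex ^ ('a \<times> 'b) ^ ('a \<times> 'b)" where
  "extend_map E \<rho> =
     (\<chi> p q. E (\<chi> i k. \<rho> $ (i, snd p) $ (k, snd q)) $ fst p $ fst q)"

definition sigma_x :: "complex ^ 2 ^ 2" where
  "sigma_x = vector [vector [0, 1], vector [1, 0]]"

definition sigma_y :: "complex ^ 2 ^ 2" where
  "sigma_y = vector [vector [0, - \<i>], vector [\<i>, 0]]"

definition sigma_z :: "complex ^ 2 ^ 2" where
  "sigma_z = vector [vector [1, 0], vector [0, - 1]]"

definition ket0 :: "complex ^ 2" where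
  "ket0 = vector [1, 0]"

definition ket1 :: "complex ^ 2" where
  "ket1 = vector [0, 1]"

definition psi :: "complex ^ (2 \<times> 2)" where
  "psi = (1 / sqrt 2) *\<^sub>R (tensor_vec ket0 ket0 + tensor_vec ket1 ket1)"

definition choi :: "(complex ^ 2 ^ 2 \<Rightarrow> complex ^ 2 ^ 2) \<Rightarrow> complex ^ (2 \<times> 2) ^ (2 \<times> 2)" where
  "choi E = extend_map E (ket_bra psi)"

definition weights :: "real \<Rightarrow> real \<Rightarrow> real \<Rightarrow> real \<Rightarrow> bool" where
  "weights \<alpha> \<beta> \<gamma> \<delta> \<longleftrightarrow>
     0 \<le> \<alpha> \<and> 0 \<le> \<beta> \<and> 0 \<le> \<gamma> \<and> 0 \<le> \<delta> \<and> \<alpha> + \<beta> + \<gamma> + \<delta> = 1"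

definition pauli_map ::
  "real \<Rightarrow> real \<Rightarrow> real \<Rightarrow> real \<Rightarrow> complex ^ 2 ^ 2 \<Rightarrow> complex ^ 2 ^ 2" where
  "pauli_map \<alpha> \<beta> \<gamma> \<delta> \<rho> =
     \<alpha> *\<^sub>R \<rho> + \<beta> *\<^sub>R (sigma_x ** \<rho> ** sigma_x)
     + \<gamma> *\<^sub>R (sigma_y ** \<rho> ** sigma_y) + \<delta> *\<^sub>R (sigma_z ** \<rho> ** sigma_z)"

definition pauli_channels :: "(complex ^ 2 ^ 2 \<Rightarrow> complex ^ 2 ^ 2) set" where
  "pauli_channels = {pauli_map \<alpha> \<beta> \<gamma> \<delta> | \<alpha> \<beta> \<gamma> \<delta>. weights \<alpha> \<beta> \<gamma> \<delta>}"

definition pauli_states :: "(complex ^ (2 \<times> 2) ^ (2 \<times> 2)) set" where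
  "pauli_states = choi ` pauli_channels"

definition state_I :: "complex ^ (2 \<times> 2) ^ (2 \<times> 2)" where
  "state_I = ket_bra psi"

definition state_X :: "complex ^ (2 \<times> 2) ^ (2 \<times> 2)" where
  "state_X = tensor_mat sigma_x (mat 1) ** ket_bra psi ** tensor_mat sigma_x (mat 1)"

definition state_Y :: "complex ^ (2 \<times> 2) ^ (2 \<times> 2)" where
  "state_Y = tensor_mat sigma_y (mat 1) ** ket_bra psi ** tensor_mat sigma_y (mat 1)"

definition state_Z :: "complex ^ (2 \<times> 2) ^ (2 \<times> 2)" where
  "state_Z = tensor_mat sigma_z (mat 1) ** ket_bra psi ** tensor_mat sigma_z (mat 1)"

definition pauli_mix :: "real \<Rightarrow> real \<Rightarrow> real \<Rightarrow> real \<Rightarrow> complex ^ (2 \<times> 2) ^ (2 \<times> 2)" where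
  "pauli_mix \<alpha> \<beta> \<gamma> \<delta> =
     \<alpha> *\<^sub>R state_I + \<beta> *\<^sub>R state_X + \<gamma> *\<^sub>R state_Y + \<delta> *\<^sub>R state_Z"

end

(* For one-qubit operators A and B, the Choi vectors (A \<otimes> I)|psi> and (B \<otimes> I)|psi> have
   inner product Tr(A^dagger B) / 2, so the rank-one states they span have Hilbert-Schmidt product
   |Tr(A^dagger B)|^2 / 4.  As the Pauli matrices are orthogonal of squared norm 2, the four states
   are orthonormal: this gives affine independence, and the weights are recovered from a mixture
   as its inner products with the vertices. *)

theory Submission
  imports Defs
begin

lemma sum_UNIV_pair:
  "(\<Sum>p\<in>(UNIV :: ('a::finite \<times> 'b::finite) set). f p) = (\<Sum>i\<in>UNIV. \<Sum>j\<in>UNIV. f (i, j))"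
  by (simp add: sum.cartesian_product)

lemma hs_inner_eq_sum:
  "hs_inner P Q = (\<Sum>i\<in>UNIV. \<Sum>j\<in>UNIV. cnj (P $ j $ i) * Q $ j $ i)"
  by (simp add: hs_inner_def trace_def matrix_matrix_mult_def dagger_def)

text \<open>The real inner product of two complex numbers a and b is the real part of
  \<open>cnj a * b\<close>. This makes the library's results on orthogonality over the reals
  available for the Hilbert-Schmidt product.\<close>

lemma inner_eq_Re_hs_inner: "P \<bullet> Q = Re (hs_inner P Q)"
proof -
  have "Re (hs_inner P Q) = (\<Sum>i\<in>UNIV. \<Sum>j\<in>UNIV. P $ j $ i \<bullet> Q $ j $ i)"
    by (simp add: hs_inner_eq_sum inner_complex_def)
  also have "\<dots> = P \<bullet> Q"
    by (subst sum.swap) (simp add: inner_vec_def)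
  finally show ?thesis by simp
qed

text \<open>The summand splits into a factor in each index, so the double sum is a product of two
  conjugate single sums.\<close>

lemma hs_inner_ket_bra:
  fixes u v :: "complex ^ 'n"
  defines "s \<equiv> \<Sum>i\<in>UNIV. cnj (u $ i) * v $ i"
  shows "hs_inner (ket_bra u) (ket_bra v) = s * cnj s"
proof -
  have "hs_inner (ket_bra u) (ket_bra v) =
      (\<Sum>i\<in>UNIV. \<Sum>j\<in>UNIV. (cnj (u $ j) * v $ j) * (u $ i * cnj (v $ i)))"
    by (simp add: hs_inner_eq_sum ket_bra_def mult_ac)
  also have "\<dots> = s * (\<Sum>i\<in>UNIV. u $ i * cnj (v $ i))"
    by (simp add: s_def sum_distrib_right[symmetric] sum_distrib_left)
  also have "(\<Sum>i\<in>UNIV. u $ i * cnj (v $ i)) = cnj s"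
    by (simp add: s_def)
  finally show ?thesis .
qed

lemma ket_bra_matrix_vector_mult: "A ** ket_bra v ** dagger A = ket_bra (A *v v)"
  by (simp add: vec_eq_iff matrix_matrix_mult_def matrix_vector_mult_def ket_bra_def dagger_def
      sum_distrib_left sum_distrib_right mult_ac)

lemma dagger_tensor_mat_one: "dagger (tensor_mat A (mat 1)) = tensor_mat (dagger A) (mat 1)"
  by (auto simp: vec_eq_iff dagger_def tensor_mat_def mat_def)

lemma tensor_mat_one_one: "tensor_mat (mat 1) (mat 1) = mat 1"
  by (auto simp: vec_eq_iff tensor_mat_def mat_def prod_eq_iff)

text \<open>The identity in the second factor is a Kronecker delta, which collapses the sum over
  pairs to its first component.\<close>

lemma tensor_mat_one_mult_nth:
  "(tensor_mat A (mat 1) ** R) $ p $ q = (\<Sum>i\<in>UNIV. A $ fst p $ i * R $ (i, snd p) $ q)"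
  by (simp add: matrix_matrix_mult_def tensor_mat_def mat_def sum_UNIV_pair if_distrib
      if_distribR cong: if_cong)

lemma mult_tensor_mat_one_nth:
  "(R ** tensor_mat A (mat 1)) $ p $ q = (\<Sum>k\<in>UNIV. R $ p $ (k, snd q) * A $ k $ fst q)"
  by (simp add: matrix_matrix_mult_def tensor_mat_def mat_def sum_UNIV_pair if_distrib
      if_distribR cong: if_cong)

text \<open>Both sides act only on first components: the entry at \<open>p\<close>, \<open>q\<close>
  involves just the block of \<open>R\<close> with second components \<open>snd p\<close> and
  \<open>snd q\<close>.\<close>

lemma extend_map_conj:
  "extend_map (\<lambda>\<rho>. A ** \<rho> ** B) R = tensor_mat A (mat 1) ** R ** tensor_mat B (mat 1)"
  by (simp add: vec_eq_iff mult_tensor_mat_one_nth tensor_mat_one_mult_nth extend_map_def)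
    (simp add: matrix_matrix_mult_def)

text \<open>Each vertex is rewritten as the extension of a conjugation map; what remains is that
  \<open>extend_map\<close> is linear in the map.\<close>

lemma choi_pauli_map: "choi (pauli_map \<alpha> \<beta> \<gamma> \<delta>) = pauli_mix \<alpha> \<beta> \<gamma> \<delta>"
  unfolding choi_def pauli_mix_def state_I_def state_X_def state_Y_def state_Z_def
    extend_map_conj[symmetric]
  by (simp add: vec_eq_iff extend_map_def pauli_map_def)

text \<open>This is the Choi matrix of the map sending \<rho> to
  \<open>A ** \<rho> ** dagger A\<close>, put in outer-product form so that
  \<open>hs_inner_ket_bra\<close> applies.\<close>

definition choi_state :: "complex ^ 2 ^ 2 \<Rightarrow> complex ^ (2 \<times> 2) ^ (2 \<times> 2)" where
  "choi_state A = ket_bra (tensor_mat A (mat 1) *v psi)"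

lemma choi_state_hermitian:
  assumes "dagger A = A"
  shows "tensor_mat A (mat 1) ** ket_bra psi ** tensor_mat A (mat 1) = choi_state A"
  using ket_bra_matrix_vector_mult[of "tensor_mat A (mat 1)" psi]
  by (simp add: choi_state_def dagger_tensor_mat_one assms)

lemma psi_nth: "psi $ (i, j) = (if i = j then complex_of_real (1 / sqrt 2) else 0)"
  using exhaust_2[of i] exhaust_2[of j]
  by (auto simp: psi_def tensor_vec_def ket0_def ket1_def scaleR_conv_of_real[where 'a = complex])

text \<open>Since \<open>psi\<close> is supported on equal indices, the Choi vector is
  \<open>A\<close> with its entries listed as a vector, up to scale.\<close>

lemma tensor_mat_one_psi_nth:
  "(tensor_mat A (mat 1) *v psi) $ p = complex_of_real (1 / sqrt 2) * A $ fst p $ snd p"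
  by (simp add: matrix_vector_mult_def tensor_mat_def mat_def sum_UNIV_pair psi_nth mult_delta_left
      mult_delta_right)

lemma hs_inner_choi_state:
  "hs_inner (choi_state A) (choi_state B) = hs_inner A B * cnj (hs_inner A B) / 4"
proof -
  have half: "complex_of_real (1 / sqrt 2) * complex_of_real (1 / sqrt 2) = 1 / 2"
    unfolding of_real_mult[symmetric] by simp
  have "(\<Sum>p\<in>UNIV. cnj ((tensor_mat A (mat 1) *v psi) $ p) * (tensor_mat B (mat 1) *v psi) $ p)
      = (\<Sum>p\<in>UNIV. (complex_of_real (1 / sqrt 2) * complex_of_real (1 / sqrt 2))
          * (cnj (A $ fst p $ snd p) * B $ fst p $ snd p))"
    by (simp only: tensor_mat_one_psi_nth complex_cnj_mult complex_cnj_complex_of_real mult_ac)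
  also have "\<dots> = hs_inner A B / 2"
    unfolding half hs_inner_eq_sum
    \<comment> \<open>The trace sums over columns outside and rows inside, whereas the sum over
      pairs has rows outside.\<close>
    by (subst sum.swap) (simp add: sum_UNIV_pair sum_divide_distrib)
  finally show ?thesis
    by (simp only: choi_state_def hs_inner_ket_bra) simp
qed

text \<open>The Pauli matrices are Hermitian, so the right factor in each vertex is the adjoint of
  the left one.\<close>

lemma states_eq_choi_state:
  "state_I = choi_state (mat 1)" "state_X = choi_state sigma_x"
  "state_Y = choi_state sigma_y" "state_Z = choi_state sigma_z"
proof -
  have "dagger sigma_x = sigma_x" "dagger sigma_y = sigma_y" "dagger sigma_z = sigma_z"
    by (simp_all add: vec_eq_iff forall_2 dagger_def sigma_x_def sigma_y_def sigma_z_def)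
  then show "state_X = choi_state sigma_x" "state_Y = choi_state sigma_y"
      "state_Z = choi_state sigma_z"
    by (simp_all add: choi_state_hermitian state_X_def state_Y_def state_Z_def)
qed (simp add: choi_state_def tensor_mat_one_one state_I_def)

lemma hs_inner_states:
  "hs_inner state_I state_I = 1" "hs_inner state_I state_X = 0"
  "hs_inner state_I state_Y = 0" "hs_inner state_I state_Z = 0"
  "hs_inner state_X state_I = 0" "hs_inner state_X state_X = 1"
  "hs_inner state_X state_Y = 0" "hs_inner state_X state_Z = 0"
  "hs_inner state_Y state_I = 0" "hs_inner state_Y state_X = 0"
  "hs_inner state_Y state_Y = 1" "hs_inner state_Y state_Z = 0"
  "hs_inner state_Z state_I = 0" "hs_inner state_Z state_X = 0"
  "hs_inner state_Z state_Y = 0" "hs_inner state_Z state_Z = 1"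
  unfolding states_eq_choi_state hs_inner_choi_state
  by (simp_all add: hs_inner_eq_sum sum_2 mat_def sigma_x_def sigma_y_def sigma_z_def)

lemmas inner_states = hs_inner_states[THEN arg_cong[of _ _ Re], folded inner_eq_Re_hs_inner,
    unfolded one_complex.sel zero_complex.sel]

lemma pauli_mix_inner:
  "pauli_mix \<alpha> \<beta> \<gamma> \<delta> \<bullet> state_I = \<alpha>" "pauli_mix \<alpha> \<beta> \<gamma> \<delta> \<bullet> state_X = \<beta>"
  "pauli_mix \<alpha> \<beta> \<gamma> \<delta> \<bullet> state_Y = \<gamma>" "pauli_mix \<alpha> \<beta> \<gamma> \<delta> \<bullet> state_Z = \<delta>"
  by (simp_all add: pauli_mix_def inner_left_distrib inner_states)

lemma pauli_mix_eq_iff: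
  "pauli_mix \<alpha> \<beta> \<gamma> \<delta> = pauli_mix \<alpha>' \<beta>' \<gamma>' \<delta>' \<longleftrightarrow>
    \<alpha> = \<alpha>' \<and> \<beta> = \<beta>' \<and> \<gamma> = \<gamma>' \<and> \<delta> = \<delta>'"
  by (metis pauli_mix_inner)

lemma states_distinct: "distinct [state_I, state_X, state_Y, state_Z]"
proof -
  have "P \<noteq> Q" if "P \<bullet> P = 1" "P \<bullet> Q = 0" for P Q :: "complex ^ (2 \<times> 2) ^ (2 \<times> 2)"
    using that by auto
  then show ?thesis
    by (simp add: inner_states)
qed

lemma states_affine_independent: "\<not> affine_dependent {state_I, state_X, state_Y, state_Z}"
proof -
  have "pairwise orthogonal {state_I, state_X, state_Y, state_Z}"
    by (auto simp: pairwise_def orthogonal_def inner_states)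
  moreover have "0 \<notin> {state_I, state_X, state_Y, state_Z}"
    using inner_states by (metis empty_iff inner_zero_left insert_iff zero_neq_one)
  ultimately have "independent {state_I, state_X, state_Y, state_Z}"
    by (rule pairwise_orthogonal_independent)
  \<comment> \<open>Nonzero orthogonal vectors are linearly independent, which is stronger than
    affine independence.\<close>
  then show ?thesis
    using affine_dependent_imp_dependent by blast
qed

lemma pauli_states_eq_mix:
  "pauli_states = {pauli_mix \<alpha> \<beta> \<gamma> \<delta> | \<alpha> \<beta> \<gamma> \<delta>. weights \<alpha> \<beta> \<gamma> \<delta>}"
  unfolding pauli_states_def pauli_channels_def choi_pauli_map[symmetric] by blast

text \<open>The points are peeled off one at a time; the weight left for the last one is forced to
  be \<open>1 - u - v - w\<close>.\<close>

lemma convex_hull_4: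
  "convex hull {a, b, c, d} = {u *\<^sub>R a + v *\<^sub>R b + w *\<^sub>R c + t *\<^sub>R d | u v w t.
     0 \<le> u \<and> 0 \<le> v \<and> 0 \<le> w \<and> 0 \<le> t \<and> u + v + w + t = 1}"
proof (intro set_eqI)
  fix x
  \<comment> \<open>After three peelings a weight function on \<open>{d}\<close> remains; only its
    value at \<open>d\<close> matters, so a constant function is a witness.\<close>
  have single: "(\<exists>f. 0 \<le> f d \<and> f d = r \<and> f d *\<^sub>R d = y) \<longleftrightarrow> 0 \<le> r \<and> r *\<^sub>R d = y" for r y
    by (auto intro: exI[of _ "\<lambda>_. r"])
  have "x \<in> convex hull {a, b, c, d} \<longleftrightarrow>
      (\<exists>u\<ge>0. \<exists>v\<ge>0. \<exists>w\<ge>0. 0 \<le> 1 - u - v - w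
        \<and> x - u *\<^sub>R a - v *\<^sub>R b - w *\<^sub>R c = (1 - u - v - w) *\<^sub>R d)"
    by (simp only: convex_hull_finite convex_hull_finite_step finite.intros mem_Collect_eq)
      (simp add: single)
  also have "\<dots> \<longleftrightarrow> (\<exists>u v w t. x = u *\<^sub>R a + v *\<^sub>R b + w *\<^sub>R c + t *\<^sub>R d
      \<and> 0 \<le> u \<and> 0 \<le> v \<and> 0 \<le> w \<and> 0 \<le> t \<and> u + v + w + t = 1)"
  proof -
    have "0 \<le> 1 - u - v - w \<and> x - u *\<^sub>R a - v *\<^sub>R b - w *\<^sub>R c = (1 - u - v - w) *\<^sub>R d \<longleftrightarrow>
        (\<exists>t. x = u *\<^sub>R a + v *\<^sub>R b + w *\<^sub>R c + t *\<^sub>R d \<and> 0 \<le> t \<and> u + v + w + t = 1)"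
      (is "?lhs \<longleftrightarrow> ?rhs") for u v w
    proof
      assume ?lhs
      then show ?rhs
        by (intro exI[of _ "1 - u - v - w"]) (auto simp: diff_eq_eq add_ac)
    next
      assume ?rhs
      then obtain t where "x = u *\<^sub>R a + v *\<^sub>R b + w *\<^sub>R c + t *\<^sub>R d" "0 \<le> t" "1 - u - v - w = t"
        by fastforce
      then show ?lhs
        by simp
    qed
    then show ?thesis
      by blast
  qed
  finally show "x \<in> convex hull {a, b, c, d} \<longleftrightarrow> x \<in> {u *\<^sub>R a + v *\<^sub>R b + w *\<^sub>R c + t *\<^sub>R d | u v w t.
     0 \<le> u \<and> 0 \<le> v \<and> 0 \<le> w \<and> 0 \<le> t \<and> u + v + w + t = 1}"
    by simp
qed

theorem mainTheorem3:
  shows "pauli_states = {pauli_mix \<alpha> \<beta> \<gamma> \<delta> | \<alpha> \<beta> \<gamma> \<delta>. weights \<alpha> \<beta> \<gamma> \<delta>}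
    \<and> 3 simplex pauli_states
    \<and> card {state_I, state_X, state_Y, state_Z} = 4
    \<and> \<not> affine_dependent {state_I, state_X, state_Y, state_Z}
    \<and> pauli_states = convex hull {state_I, state_X, state_Y, state_Z}
    \<and> {v. v extreme_point_of pauli_states} = {state_I, state_X, state_Y, state_Z}
    \<and> pairwise (\<lambda>P Q. hs_inner P Q = 0) {state_I, state_X, state_Y, state_Z}
    \<and> (\<forall>\<rho> \<in> pauli_states. \<exists>!(\<alpha>, \<beta>, \<gamma>, \<delta>).
          weights \<alpha> \<beta> \<gamma> \<delta> \<and> \<rho> = pauli_mix \<alpha> \<beta> \<gamma> \<delta>)"
proof -
  let ?V = "{state_I, state_X, state_Y, state_Z}"
  have card: "card ?V = 4"
    using distinct_card[OF states_distinct] by simp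
  have hull: "pauli_states = convex hull ?V"
    unfolding pauli_states_eq_mix convex_hull_4 weights_def pauli_mix_def ..
  \<comment> \<open>A simplex of dimension 3 has 3 + 1 vertices, hence the cardinality 4.\<close>
  have simplex: "3 simplex pauli_states"
    unfolding simplex_def using card hull states_affine_independent by (intro exI[of _ ?V]) simp
  \<comment> \<open>The extreme points of the hull of an affinely independent set are exactly its
    generators.\<close>
  have extreme: "{v. v extreme_point_of pauli_states} = ?V"
    using extreme_point_of_convex_hull_affine_independent[OF states_affine_independent] hull
    by auto
  have orthogonal: "pairwise (\<lambda>P Q. hs_inner P Q = 0) ?V"
    by (auto simp: pairwise_def hs_inner_states)
  have unique: "\<exists>!(\<alpha>, \<beta>, \<gamma>, \<delta>). weights \<alpha> \<beta> \<gamma> \<delta> \<and> \<rho> = pauli_mix \<alpha> \<beta> \<gamma> \<delta>"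
    if "\<rho> \<in> pauli_states" for \<rho>
  proof -
    obtain \<alpha> \<beta> \<gamma> \<delta> where "weights \<alpha> \<beta> \<gamma> \<delta>" "\<rho> = pauli_mix \<alpha> \<beta> \<gamma> \<delta>"
      using \<open>\<rho> \<in> pauli_states\<close> unfolding pauli_states_eq_mix by blast
    \<comment> \<open>Existence is membership; uniqueness holds because the weights are coordinates
      in an orthonormal family.\<close>
    then show ?thesis
      by (intro ex1I[of _ "(\<alpha>, \<beta>, \<gamma>, \<delta>)"]) (auto simp: pauli_mix_eq_iff)
  qed
  show ?thesis
    by (intro conjI ballI pauli_states_eq_mix simplex card states_affine_independent hull extreme
        orthogonal unique)
qed

end
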